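(* Let $\mathbb{F}=\mathbb{R}$ or $\mathbb{F}=\mathbb{C}$, let $m\ge n$ be positive integers, and let $T\in\mathbb{F}^{m\times n}$, $S\in\mathbb{F}^{n\times n}$, $W\in\mathbb{F}^{n\times m}$. Put $A=TSW\in\mathbb{F}^{m\times m}$ and $B=(WT)S\in\mathbb{F}^{n\times n}$. Let $\mu\in\mathbb{F}$ with $\mu\ne 0$, and assume that $\mu I_n-B$ is invertible. Then $\mu I_m-A$ is invertible and $$(\mu I_m-A)^{-1}=\frac{1}{\mu}I_m+\frac{1}{\mu}\,TS\,(\mu I_n-B)^{-1}W.$$
   Context: $I_k$ denotes the $k\times k$ identity matrix. *)

theory Defs
  imports "HOL-Analysis.Analysis"
begin

(* HOL-Analysis has scalar multiplication of vectors over any ring ( *s ), but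
   scalar multiplication of matrices only for real scalars ( *\<^sub>R ). *)
definition smult_matrix :: "'a::times \<Rightarrow> 'a^'n^'m \<Rightarrow> 'a^'n^'m"  (infixr \<open>*\<^sub>m\<close> 75)
  where "c *\<^sub>m A = (\<chi> i j. c * A $ i $ j)"

end

theory Submission
  imports Defs
begin

text \<open>
  With \<open>U = T S\<close>, the matrices in the theorem are \<open>A = U W\<close> and \<open>B = W U\<close>: the same two factors in
  opposite orders.  Hence \<open>U\<close> and \<open>W\<close> intertwine \<open>\<mu> I - U W\<close> with \<open>\<mu> I - W U\<close>
  (\<open>shifted_products_intertwine\<close>): \<open>(\<mu> I - U W) U = U (\<mu> I - W U)\<close> and
  \<open>W (\<mu> I - U W) = (\<mu> I - W U) W\<close>.  If \<open>M\<close> inverts \<open>\<mu> I - W U\<close>, multiplying \<open>I + U M W\<close> by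
  \<open>\<mu> I - U W\<close> on the left therefore gives
  \<open>(\<mu> I - U W) + U (\<mu> I - W U) M W = (\<mu> I - U W) + U W = \<mu> I\<close>,
  and symmetrically on the right.  Dividing by \<open>\<mu>\<close> exhibits a two-sided inverse of \<open>\<mu> I - U W\<close>.
  The argument only uses the field axioms, so the real and complex cases are instances of
  \<open>resolvent_swap\<close>.
\<close>

lemma matrix_diff_ldistrib:
  fixes A :: "'a::ring_1^'n^'m"
  shows "A ** (B - C) = A ** B - A ** C"
  by (simp add: matrix_matrix_mult_def vec_eq_iff right_diff_distrib sum_subtractf)

lemma matrix_diff_rdistrib:
  fixes A :: "'a::ring_1^'n^'m"
  shows "(A - B) ** C = A ** C - B ** C"
  by (simp add: matrix_matrix_mult_def vec_eq_iff left_diff_distrib sum_subtractf)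

lemma matrix_add_rdistrib:
  fixes A :: "'a::semiring_1^'n^'m"
  shows "(A + B) ** C = A ** C + B ** C"
  by (simp add: matrix_matrix_mult_def vec_eq_iff distrib_right sum.distrib)

lemma smult_matrix_mult_left:
  fixes A :: "'a::comm_ring_1^'n^'m"
  shows "(c *\<^sub>m A) ** B = c *\<^sub>m (A ** B)"
  by (simp add: smult_matrix_def matrix_matrix_mult_def vec_eq_iff sum_distrib_left mult.assoc)

lemma smult_matrix_mult_right:
  fixes A :: "'a::comm_ring_1^'n^'m"
  shows "A ** (c *\<^sub>m B) = c *\<^sub>m (A ** B)"
  by (simp add: smult_matrix_def matrix_matrix_mult_def vec_eq_iff sum_distrib_left mult.left_commute)

lemma smult_matrix_add:
  fixes A :: "'a::comm_ring_1^'n^'m"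
  shows "c *\<^sub>m (A + B) = c *\<^sub>m A + c *\<^sub>m B"
  by (simp add: smult_matrix_def vec_eq_iff distrib_left)

lemma smult_matrix_inverse_cancel:
  fixes A :: "'a::field^'n^'m"
  assumes "c \<noteq> 0"
  shows "(1 / c) *\<^sub>m (c *\<^sub>m A) = A"
  using assms by (simp add: smult_matrix_def vec_eq_iff)

lemma matrix_inv_inverse:
  fixes A :: "'a::semiring_1^'n^'m"
  assumes "invertible A"
  shows "A ** matrix_inv A = mat 1" and "matrix_inv A ** A = mat 1"
  using someI_ex [OF assms [unfolded invertible_def]] by (simp_all add: matrix_inv_def)

lemma matrix_inv_eqI:
  fixes A :: "'a::semiring_1^'n^'m"
  assumes "A ** X = mat 1" and "X ** A = mat 1"
  shows "matrix_inv A = X"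
proof -
  have "invertible A"
    using assms unfolding invertible_def by blast
  then have "matrix_inv A = matrix_inv A ** (A ** X)"
    by (simp add: assms)
  also have "\<dots> = (matrix_inv A ** A) ** X"
    by (simp only: matrix_mul_assoc)
  also have "\<dots> = X"
    using \<open>invertible A\<close> by (simp add: matrix_inv_inverse)
  finally show ?thesis .
qed

text \<open>
  Both sides equal \<open>\<mu> U - U W U\<close>, since \<open>U W U\<close> can be bracketed either way.
  Exchanging the roles of \<open>U\<close> and \<open>W\<close> gives the identity for multiplication from the
  other side.
\<close>
lemma shifted_products_intertwine:
  fixes U :: "'a::comm_ring_1^'n^'m" and W :: "'a^'m^'n"
  shows "(\<mu> *\<^sub>m mat 1 - U ** W) ** U = U ** (\<mu> *\<^sub>m mat 1 - W ** U)"
  by (simp add: matrix_diff_ldistrib matrix_diff_rdistrib smult_matrix_mult_left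
      smult_matrix_mult_right matrix_mul_assoc)

text \<open>
  The formula is the closed form of the Neumann series for the inverse of \<open>\<mu> I - U W\<close>:
  for \<open>k > 0\<close> the \<open>k\<close>-th power of \<open>U W\<close> is \<open>U\<close> times the \<open>(k - 1)\<close>-st power of \<open>W U\<close> times \<open>W\<close>, so the terms with
  \<open>k > 0\<close> resum to the inverse of \<open>\<mu> I - W U\<close> between \<open>U\<close> and \<open>W\<close>, divided by \<open>\<mu>\<close>.  The
  intertwining relation verifies the result algebraically, for every \<open>\<mu> \<noteq> 0\<close> where that inverse exists.
\<close>
lemma resolvent_swap:
  fixes U :: "'a::field^'n^'m" and W :: "'a^'m^'n"
  assumes "\<mu> \<noteq> 0" and inv: "invertible (\<mu> *\<^sub>m mat 1 - W ** U)"
  defines "M \<equiv> matrix_inv (\<mu> *\<^sub>m mat 1 - W ** U)"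
  shows "invertible (\<mu> *\<^sub>m mat 1 - U ** W) \<and>
    matrix_inv (\<mu> *\<^sub>m mat 1 - U ** W) =
      (1 / \<mu>) *\<^sub>m mat 1 + (1 / \<mu>) *\<^sub>m (U ** M ** W)"
proof -
  define P where "P = \<mu> *\<^sub>m mat 1 - U ** W"
  define Q where "Q = \<mu> *\<^sub>m mat 1 - W ** U"
  define X where "X = (1 / \<mu>) *\<^sub>m (mat 1 + U ** M ** W)"
  have QM: "Q ** M = mat 1" and MQ: "M ** Q = mat 1"
    using matrix_inv_inverse [OF inv] by (simp_all add: M_def Q_def)
  have "P ** (U ** M ** W) = U ** W"
  proof -
    have "P ** (U ** M ** W) = (P ** U) ** M ** W"
      by (simp add: matrix_mul_assoc)
    also have "\<dots> = U ** (Q ** M) ** W"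
      using shifted_products_intertwine [of \<mu> U W] by (simp only: P_def Q_def matrix_mul_assoc)
    finally show ?thesis
      by (simp add: QM)
  qed
  then have "P ** (mat 1 + U ** M ** W) = \<mu> *\<^sub>m mat 1"
    by (simp add: matrix_add_ldistrib P_def)
  then have PX: "P ** X = mat 1"
    using \<open>\<mu> \<noteq> 0\<close> by (simp add: X_def smult_matrix_mult_right smult_matrix_inverse_cancel)
  have "(U ** M ** W) ** P = U ** W"
  proof -
    have "(U ** M ** W) ** P = U ** M ** (W ** P)"
      by (simp add: matrix_mul_assoc)
    also have "W ** P = Q ** W"
      by (simp add: P_def Q_def shifted_products_intertwine)
    also have "U ** M ** (Q ** W) = U ** (M ** Q) ** W"
      by (simp only: matrix_mul_assoc)
    finally show ?thesis
      by (simp add: MQ)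
  qed
  then have "(mat 1 + U ** M ** W) ** P = \<mu> *\<^sub>m mat 1"
    by (simp add: matrix_add_rdistrib P_def)
  then have XP: "X ** P = mat 1"
    using \<open>\<mu> \<noteq> 0\<close> by (simp add: X_def smult_matrix_mult_left smult_matrix_inverse_cancel)
  have "invertible P"
    using PX XP unfolding invertible_def by blast
  moreover have "matrix_inv P = X"
    using PX XP by (rule matrix_inv_eqI)
  ultimately show ?thesis
    by (simp add: P_def X_def smult_matrix_add)
qed

theorem theorem7p2:
  assumes "CARD('n::finite) \<le> CARD('m::finite)"
  shows
    "(\<forall>(T::real^'n^'m) (S::real^'n^'n) (W::real^'m^'n) (\<mu>::real).
        let A = T ** S ** W; B = (W ** T) ** S in
        \<mu> \<noteq> 0 \<longrightarrow> invertible (\<mu> *\<^sub>m mat 1 - B) \<longrightarrow>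
        invertible (\<mu> *\<^sub>m mat 1 - A) \<and>
        matrix_inv (\<mu> *\<^sub>m mat 1 - A) =
          (1 / \<mu>) *\<^sub>m mat 1 +
          (1 / \<mu>) *\<^sub>m (T ** S ** matrix_inv (\<mu> *\<^sub>m mat 1 - B) ** W)) \<and>
     (\<forall>(T::complex^'n^'m) (S::complex^'n^'n) (W::complex^'m^'n) (\<mu>::complex).
        let A = T ** S ** W; B = (W ** T) ** S in
        \<mu> \<noteq> 0 \<longrightarrow> invertible (\<mu> *\<^sub>m mat 1 - B) \<longrightarrow>
        invertible (\<mu> *\<^sub>m mat 1 - A) \<and>
        matrix_inv (\<mu> *\<^sub>m mat 1 - A) =
          (1 / \<mu>) *\<^sub>m mat 1 +
          (1 / \<mu>) *\<^sub>m (T ** S ** matrix_inv (\<mu> *\<^sub>m mat 1 - B) ** W))"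
proof -
  have swap: "\<mu> \<noteq> 0 \<longrightarrow> invertible (\<mu> *\<^sub>m mat 1 - (W ** T) ** S) \<longrightarrow>
        invertible (\<mu> *\<^sub>m mat 1 - T ** S ** W) \<and>
        matrix_inv (\<mu> *\<^sub>m mat 1 - T ** S ** W) =
          (1 / \<mu>) *\<^sub>m mat 1 +
          (1 / \<mu>) *\<^sub>m (T ** S ** matrix_inv (\<mu> *\<^sub>m mat 1 - (W ** T) ** S) ** W)"
    for T :: "'a::field^'n^'m" and S :: "'a^'n^'n" and W :: "'a^'m^'n" and \<mu>
    using resolvent_swap [of \<mu> W "T ** S"] unfolding matrix_mul_assoc [of W T S] by blast
  show ?thesis
    unfolding Let_def by (intro conjI allI; rule swap)
qed

end
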